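(* Let $k$ be an algebraically closed field, let $r\ge 3$, and let $M\in\mathrm{rep}(C_r)$ be an indecomposable representation. The following statements are equivalent: (a) $N:=\pi_\lambda(M)$ has the equal images property, i.e. $\sum_{i=1}^r\alpha_iN(\gamma_i)\colon N_1\to N_2$ is surjective for all $\alpha\in k^r\setminus\{0\}$. (b) $N(\gamma_i)$ is surjective for all $i\in\{1,\dots,r\}$. (c) $M\in\mathrm{Surj}$, i.e. $M(\delta)$ is surjective for every arrow $\delta$ of $C_r$.
   Context: $k$ has arbitrary characteristic. $\Gamma_r$ is the quiver with two vertices $1,2$ and $r$ arrows $\gamma_1,\dots,\gamma_r\colon 1\to 2$; $\mathrm{rep}(\Gamma_r)$ is the category of its finite-dimensional representations over $k$. Universal cover. Consider walks in $\Gamma_r$ (formal composable sequences of arrows and formal inverses of arrows, written right to left, including the trivial walks $\epsilon_1,\epsilon_2$) modulo the equivalence relation generated by $\gamma_i^{-1}\gamma_i\sim\epsilon_1$, $\gamma_i\gamma_i^{-1}\sim\epsilon_2$. The quiver $C_r$ has as vertices the classes $[w]$ of walks $w$ starting in $1$, and an arrow $[w]\to[\gamma_iw]$ for each $i$ and each $[w]$ with $t(w)=1$, where $t(w)$ is the end vertex of $w$. Its underlying graph is an $r$-regular tree and each vertex is a source or a sink. The quiver morphism $\pi\colon C_r\to\Gamma_r$ is given by $[w]\mapsto t(w)$, $([w]\to[\gamma_iw])\mapsto\gamma_i$. $\mathrm{rep}(C_r)$ is the category of representations of $C_r$ of finite total dimension. The push-down functor $\pi_\lambda\colon\mathrm{rep}(C_r)\to\mathrm{rep}(\Gamma_r)$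 is given by $\pi_\lambda(M)_i=\bigoplus_{\pi(y)=i}M_y$ for $i\in\{1,2\}$ and $\pi_\lambda(M)(\gamma_i)=\bigoplus_{\pi(\beta)=\gamma_i}M(\beta)$ for $1\le i\le r$, and analogously on morphisms. *)

theory Defs
  imports
    "Graph_Theory.Digraph"
    "HOL-Computational_Algebra.Polynomial"
    "HOL-Library.Function_Algebras"
begin

section \<open>Representations of quivers\<close>

text \<open>
  A quiver is a (possibly infinite) directed multigraph.  The vector spaces of a representation
  are subspaces of one ambient vector space \<open>'v\<close>, given by its scalar multiplication \<open>scale\<close>;
  as \<open>'v\<close> is arbitrary, this is no restriction.  Only the values of \<open>rep_space\<close> at vertices and
  those of \<open>rep_map\<close> at arrows, restricted to the space at the tail, matter.
\<close>

record ('x, 'e, 'v) quiver_rep =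
  rep_space :: "'x \<Rightarrow> 'v set"
  rep_map :: "'e \<Rightarrow> 'v \<Rightarrow> 'v"

definition linear_between ::
    "('k::field \<Rightarrow> 'v::ab_group_add \<Rightarrow> 'v) \<Rightarrow> 'v set \<Rightarrow> 'v set \<Rightarrow> ('v \<Rightarrow> 'v) \<Rightarrow> bool" where
  "linear_between scale V W f \<longleftrightarrow>
     (\<forall>u\<in>V. f u \<in> W) \<and>
     (\<forall>u\<in>V. \<forall>v\<in>V. f (u + v) = f u + f v) \<and>
     (\<forall>c. \<forall>u\<in>V. f (scale c u) = scale c (f u))"

definition is_rep ::
    "('k::field \<Rightarrow> 'v::ab_group_add \<Rightarrow> 'v) \<Rightarrow> ('x, 'e) pre_digraph \<Rightarrow> ('x, 'e, 'v) quiver_rep \<Rightarrow> bool"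
  where
  "is_rep scale Q M \<longleftrightarrow>
     (\<forall>x\<in>verts Q. module.subspace scale (rep_space M x)) \<and>
     (\<forall>e\<in>arcs Q. linear_between scale
        (rep_space M (tail Q e)) (rep_space M (head Q e)) (rep_map M e))"

definition fin_dim_rep ::
    "('k::field \<Rightarrow> 'v::ab_group_add \<Rightarrow> 'v) \<Rightarrow> ('x, 'e) pre_digraph \<Rightarrow> ('x, 'e, 'v) quiver_rep \<Rightarrow> bool"
  where
  "fin_dim_rep scale Q M \<longleftrightarrow>
     is_rep scale Q M \<and>
     finite {x \<in> verts Q. rep_space M x \<noteq> {0}} \<and>
     (\<forall>x\<in>verts Q. \<exists>B. finite B \<and> module.span scale B = rep_space M x)"

definition subrep ::
    "('k::field \<Rightarrow> 'v::ab_group_add \<Rightarrow> 'v) \<Rightarrow> ('x, 'e) pre_digraph \<Rightarrow> ('x, 'e, 'v) quiver_rep \<Rightarrow>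
       ('x \<Rightarrow> 'v set) \<Rightarrow> bool" where
  "subrep scale Q M U \<longleftrightarrow>
     (\<forall>x\<in>verts Q. module.subspace scale (U x) \<and> U x \<subseteq> rep_space M x) \<and>
     (\<forall>e\<in>arcs Q. rep_map M e ` U (tail Q e) \<subseteq> U (head Q e))"

definition direct_decomposition ::
    "('k::field \<Rightarrow> 'v::ab_group_add \<Rightarrow> 'v) \<Rightarrow> ('x, 'e) pre_digraph \<Rightarrow> ('x, 'e, 'v) quiver_rep \<Rightarrow>
       ('x \<Rightarrow> 'v set) \<Rightarrow> ('x \<Rightarrow> 'v set) \<Rightarrow> bool" where
  "direct_decomposition scale Q M U W \<longleftrightarrow>
     subrep scale Q M U \<and> subrep scale Q M W \<and>
     (\<forall>x\<in>verts Q. U x \<inter> W x = {0} \<and> {u + w | u w. u \<in> U x \<and> w \<in> W x} = rep_space M x)"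

definition indecomposable_rep ::
    "('k::field \<Rightarrow> 'v::ab_group_add \<Rightarrow> 'v) \<Rightarrow> ('x, 'e) pre_digraph \<Rightarrow> ('x, 'e, 'v) quiver_rep \<Rightarrow> bool"
  where
  "indecomposable_rep scale Q M \<longleftrightarrow>
     (\<exists>x\<in>verts Q. rep_space M x \<noteq> {0}) \<and>
     (\<forall>U W. direct_decomposition scale Q M U W \<longrightarrow>
        (\<forall>x\<in>verts Q. U x = {0}) \<or> (\<forall>x\<in>verts Q. W x = {0}))"

definition surj_rep :: "('x, 'e) pre_digraph \<Rightarrow> ('x, 'e, 'v) quiver_rep \<Rightarrow> bool" where
  "surj_rep Q M \<longleftrightarrow>
     (\<forall>e\<in>arcs Q. rep_map M e ` rep_space M (tail Q e) = rep_space M (head Q e))"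


section \<open>The universal cover of a quiver\<close>

datatype 'e letter = Fwd 'e | Inv 'e

text \<open>
  \<open>walk Q x y w\<close>: \<open>w\<close> is a walk from \<open>x\<close> to \<open>y\<close>.  As walks are written right to left, the head of
  the list is the last step; the empty list is the trivial walk at \<open>x\<close>.
\<close>

inductive walk :: "('x, 'e) pre_digraph \<Rightarrow> 'x \<Rightarrow> 'x \<Rightarrow> 'e letter list \<Rightarrow> bool"
  for Q :: "('x, 'e) pre_digraph" and x :: 'x where
  trivial: "x \<in> verts Q \<Longrightarrow> walk Q x x []"
| forward: "walk Q x (tail Q e) w \<Longrightarrow> e \<in> arcs Q \<Longrightarrow> walk Q x (head Q e) (Fwd e # w)"
| inverse: "walk Q x (head Q e) w \<Longrightarrow> e \<in> arcs Q \<Longrightarrow> walk Q x (tail Q e) (Inv e # w)"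

definition walks_from :: "('x, 'e) pre_digraph \<Rightarrow> 'x \<Rightarrow> 'e letter list set" where
  "walks_from Q x = {w. \<exists>y. walk Q x y w}"

inductive cancel :: "'e letter list \<Rightarrow> 'e letter list \<Rightarrow> bool" where
  "cancel (u @ Inv e # Fwd e # v) (u @ v)"
| "cancel (u @ Fwd e # Inv e # v) (u @ v)"

definition walk_equiv :: "('x, 'e) pre_digraph \<Rightarrow> 'x \<Rightarrow> ('e letter list \<times> 'e letter list) set" where
  "walk_equiv Q x = {(w, w'). w \<in> walks_from Q x \<and> w' \<in> walks_from Q x \<and>
     equivclp (\<lambda>v v'. v \<in> walks_from Q x \<and> v' \<in> walks_from Q x \<and> cancel v v') w w'}"

text \<open>The end vertex \<open>t(w)\<close> of a class \<open>[w]\<close>; see \<open>class_end_eq\<close> below for well-definedness.\<close>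

definition class_end :: "('x, 'e) pre_digraph \<Rightarrow> 'x \<Rightarrow> 'e letter list set \<Rightarrow> 'x" where
  "class_end Q x c = (THE y. \<exists>w\<in>c. walk Q x y w)"

text \<open>The arrow \<open>[w] \<rightarrow> [\<gamma>w]\<close> is encoded as the pair of \<open>[w]\<close> and \<open>\<gamma>\<close>.\<close>

definition universal_cover ::
    "('x, 'e) pre_digraph \<Rightarrow> 'x \<Rightarrow> ('e letter list set, 'e letter list set \<times> 'e) pre_digraph" where
  "universal_cover Q x =
     \<lparr> verts = walks_from Q x // walk_equiv Q x,
       arcs = {(c, e). c \<in> walks_from Q x // walk_equiv Q x \<and> e \<in> arcs Q \<and>
                 class_end Q x c = tail Q e},
       tail = fst,
       head = (\<lambda>(c, e). \<Union>w\<in>c. walk_equiv Q x `` {Fwd e # w}) \<rparr>"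


section \<open>Push-down\<close>

definition fun_scale :: "('k \<Rightarrow> 'v \<Rightarrow> 'v) \<Rightarrow> 'k \<Rightarrow> ('x \<Rightarrow> 'v) \<Rightarrow> 'x \<Rightarrow> 'v" where
  "fun_scale scale c f = (\<lambda>y. scale c (f y))"

text \<open>
  \<open>pv\<close> and \<open>pe\<close> are the vertex and arrow part of a quiver morphism out of \<open>C\<close>.  The elements of
  the direct sum of the spaces over the fibre of \<open>i\<close> are the finitely supported families indexed by
  the fibre, extended by \<open>0\<close>.  The component at \<open>y\<close> of the image of \<open>f\<close> collects the contributions
  of all arrows over \<open>g\<close> ending in \<open>y\<close>; for a universal cover there is at most one
  (lemma \<open>card_fibre_arcs_head\<close>).
\<close>

definition push_down ::
    "('y, 'b) pre_digraph \<Rightarrow> ('y \<Rightarrow> 'x) \<Rightarrow> ('b \<Rightarrow> 'e) \<Rightarrow>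
       ('y, 'b, 'v::ab_group_add) quiver_rep \<Rightarrow> ('x, 'e, 'y \<Rightarrow> 'v) quiver_rep" where
  "push_down C pv pe M =
     \<lparr> rep_space = (\<lambda>i. {f. finite {y. f y \<noteq> 0} \<and>
         (\<forall>y. if y \<in> verts C \<and> pv y = i then f y \<in> rep_space M y else f y = 0)}),
       rep_map = (\<lambda>g f y. \<Sum>b\<in>{b \<in> arcs C. pe b = g \<and> head C b = y}. rep_map M b (f (tail C b))) \<rparr>"


section \<open>The Kronecker quivers and their covers\<close>

definition kronecker :: "nat \<Rightarrow> (nat, nat) pre_digraph" where
  "kronecker r = \<lparr> verts = {1, 2}, arcs = {1..r}, tail = (\<lambda>_. 1), head = (\<lambda>_. 2) \<rparr>"

type_synonym cover_vertex = "nat letter list set"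
type_synonym cover_arrow = "cover_vertex \<times> nat"

definition kronecker_cover :: "nat \<Rightarrow> (cover_vertex, cover_arrow) pre_digraph" where
  "kronecker_cover r = universal_cover (kronecker r) 1"

definition kronecker_push_down ::
    "nat \<Rightarrow> (cover_vertex, cover_arrow, 'v::ab_group_add) quiver_rep \<Rightarrow>
       (nat, nat, cover_vertex \<Rightarrow> 'v) quiver_rep" where
  "kronecker_push_down r M =
     push_down (kronecker_cover r) (class_end (kronecker r) 1) snd M"

definition equal_images_property ::
    "('k::field \<Rightarrow> 'v::ab_group_add \<Rightarrow> 'v) \<Rightarrow> nat \<Rightarrow> (nat, nat, 'v) quiver_rep \<Rightarrow> bool" where
  "equal_images_property scale r N \<longleftrightarrow>
     (\<forall>\<alpha> :: nat \<Rightarrow> 'k. (\<exists>i\<in>{1..r}. \<alpha> i \<noteq> 0) \<longrightarrow>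
        (\<lambda>v. \<Sum>i=1..r. scale (\<alpha> i) (rep_map N i v)) ` rep_space N 1 = rep_space N 2)"


section \<open>Well-definedness\<close>

lemma walk_simps [simp]:
  "walk Q x y [] \<longleftrightarrow> y = x \<and> x \<in> verts Q"
  "walk Q x y (Fwd e # w) \<longleftrightarrow> y = head Q e \<and> e \<in> arcs Q \<and> walk Q x (tail Q e) w"
  "walk Q x y (Inv e # w) \<longleftrightarrow> y = tail Q e \<and> e \<in> arcs Q \<and> walk Q x (head Q e) w"
  by (subst walk.simps; blast)+

lemma walk_end_unique: "walk Q x y w \<Longrightarrow> walk Q x z w \<Longrightarrow> y = z"
  by (induction rule: walk.induct) simp_all

lemma walk_append_mono:
  assumes "\<And>y. walk Q x y v \<Longrightarrow> walk Q x y v'" "walk Q x y (u @ v)"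
  shows "walk Q x y (u @ v')"
  using assms(2)
proof (induction u arbitrary: y)
  case Nil
  then show ?case using assms(1) by simp
next
  case (Cons a u)
  then show ?case by (cases a) simp_all
qed

lemma cancel_walk_end:
  assumes "cancel w w'" "walk Q x y w"
  shows "walk Q x y w'"
  using assms(1)
proof cases
  case (1 u e v)
  show ?thesis
    using walk_append_mono[of Q x "Inv e # Fwd e # v" v y u] assms(2) 1 by simp
next
  case (2 u e v)
  show ?thesis
    using walk_append_mono[of Q x "Fwd e # Inv e # v" v y u] assms(2) 2 by simp
qed

lemma walk_equiv_end:
  assumes "(w, w') \<in> walk_equiv Q x"
  shows "walk Q x y w \<longleftrightarrow> walk Q x y w'"
proof -
  let ?R = "\<lambda>v v'. v \<in> walks_from Q x \<and> v' \<in> walks_from Q x \<and> cancel v v'"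
  have step: "walk Q x y v \<longleftrightarrow> walk Q x y v'" if "?R v v'" for v v' y
    using that cancel_walk_end[of v v' Q x] walk_end_unique[of Q x]
    unfolding walks_from_def by blast
  from assms have "equivclp ?R w w'" by (simp add: walk_equiv_def)
  then show ?thesis
    by (induction rule: equivclp_induct) (use step in blast)+
qed

lemma equiv_walk_equiv: "equiv (walks_from Q x) (walk_equiv Q x)"
proof (rule equivI)
  show "walk_equiv Q x \<subseteq> walks_from Q x \<times> walks_from Q x" by (auto simp: walk_equiv_def)
  show "refl_on (walks_from Q x) (walk_equiv Q x)"
    by (auto simp: refl_on_def walk_equiv_def)
  show "sym (walk_equiv Q x)" 
    unfolding walk_equiv_def by (rule symI) (clarsimp, erule equivclp_sym)
  show "trans (walk_equiv Q x)"
    unfolding walk_equiv_def by (rule transI) (clarsimp, erule (1) equivclp_trans)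
qed

lemma class_end_eq:
  assumes "walk Q x y w"
  shows "class_end Q x (walk_equiv Q x `` {w}) = y"
  unfolding class_end_def
proof (rule the_equality)
  have "w \<in> walks_from Q x" using assms by (auto simp: walks_from_def)
  then have "(w, w) \<in> walk_equiv Q x" by (auto simp: walk_equiv_def)
  then show "\<exists>w\<in>walk_equiv Q x `` {w}. walk Q x y w" using assms by auto
next
  fix z assume "\<exists>w\<in>walk_equiv Q x `` {w}. walk Q x z w"
  then show "z = y" using assms walk_equiv_end walk_end_unique by (metis Image_singleton_iff)
qed

lemma walk_equiv_Cons:
  assumes "(w, w') \<in> walk_equiv Q x" "a # w \<in> walks_from Q x"
  shows "(a # w, a # w') \<in> walk_equiv Q x"
proof -
  let ?R = "\<lambda>v v'. v \<in> walks_from Q x \<and> v' \<in> walks_from Q x \<and> cancel v v'"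
  have Cons: "cancel (a # u) (a # v)" if "cancel u v" for u v
    using that by cases (metis append_Cons cancel.intros)+
  have W: "a # v' \<in> walks_from Q x"
    if "(v, v') \<in> walk_equiv Q x" "a # v \<in> walks_from Q x" for v v'
    using walk_append_mono[of Q x v v' _ "[a]"] walk_equiv_end[OF that(1)] that(2)
    by (auto simp: walks_from_def)
  from assms(1) have "equivclp ?R w w'" "w \<in> walks_from Q x" by (auto simp: walk_equiv_def)
  then have "w' \<in> walks_from Q x \<and> (a # w, a # w') \<in> walk_equiv Q x"
  proof (induction rule: equivclp_induct)
    case base
    then show ?case using assms(2) by (simp add: walk_equiv_def)
  next
    case (step v v')
    then have v: "(a # w, a # v) \<in> walk_equiv Q x" by blast
    then have av: "a # v \<in> walks_from Q x" by (simp add: walk_equiv_def)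
    from step(2) have vv': "(v, v') \<in> walk_equiv Q x"
      using r_into_equivclp[of ?R v v'] converse_r_into_equivclp[of ?R v' v]
      unfolding walk_equiv_def by blast
    have "a # v' \<in> walks_from Q x" using W[OF vv' av] .
    then have "(a # v, a # v') \<in> walk_equiv Q x"
      using step(2) av Cons r_into_equivclp[of ?R "a # v" "a # v'"]
        converse_r_into_equivclp[of ?R "a # v'" "a # v"]
      unfolding walk_equiv_def by blast
    then have "(a # w, a # v') \<in> walk_equiv Q x"
      using v equiv_walk_equiv[of Q x] unfolding equiv_def by (meson transD)
    then show ?case using vv' by (simp add: walk_equiv_def)
  qed
  then show ?thesis by blast
qed

lemma arcs_universal_cover_iff:
  "b \<in> arcs (universal_cover Q x) \<longleftrightarrow>
     (\<exists>w e. b = (walk_equiv Q x `` {w}, e) \<and> e \<in> arcs Q \<and> walk Q x (tail Q e) w)"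
  by (auto simp: universal_cover_def quotient_def walks_from_def class_end_eq)

lemma head_universal_cover:
  assumes "walk Q x (tail Q e) w" "e \<in> arcs Q"
  shows "head (universal_cover Q x) (walk_equiv Q x `` {w}, e) = walk_equiv Q x `` {Fwd e # w}"
proof -
  have w: "w \<in> walks_from Q x" and ew: "Fwd e # w \<in> walks_from Q x"
    using assms by (auto simp: walks_from_def)
  have "walk_equiv Q x `` {Fwd e # v} = walk_equiv Q x `` {Fwd e # w}"
    if "v \<in> walk_equiv Q x `` {w}" for v
  proof -
    from that have "(w, v) \<in> walk_equiv Q x" by simp
    from equiv_class_eq[OF equiv_walk_equiv walk_equiv_Cons[OF this ew]] show ?thesis by simp
  qed
  moreover have "w \<in> walk_equiv Q x `` {w}" using w by (auto simp: walk_equiv_def)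
  ultimately have "(\<Union>v\<in>walk_equiv Q x `` {w}. walk_equiv Q x `` {Fwd e # v}) =
      walk_equiv Q x `` {Fwd e # w}"
    by (intro SUP_eq_const) blast+
  then show ?thesis unfolding universal_cover_def by simp
qed

lemma wf_universal_cover: "wf_digraph (universal_cover Q x)"
proof unfold_locales
  fix b assume b: "b \<in> arcs (universal_cover Q x)"
  then show "tail (universal_cover Q x) b \<in> verts (universal_cover Q x)"
    by (auto simp: universal_cover_def)
  from b obtain w e where we: "b = (walk_equiv Q x `` {w}, e)" "e \<in> arcs Q" "walk Q x (tail Q e) w"
    by (auto simp: arcs_universal_cover_iff)
  then have "Fwd e # w \<in> walks_from Q x" by (auto simp: walks_from_def)
  then show "head (universal_cover Q x) b \<in> verts (universal_cover Q x)"
    unfolding we(1) head_universal_cover[OF we(3,2)]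
    by (simp add: universal_cover_def quotientI)
qed

lemma universal_cover_morphism:
  assumes "b \<in> arcs (universal_cover Q x)"
  shows "snd b \<in> arcs Q"
    and "class_end Q x (tail (universal_cover Q x) b) = tail Q (snd b)"
    and "class_end Q x (head (universal_cover Q x) b) = head Q (snd b)"
proof -
  from assms obtain w e
    where we: "b = (walk_equiv Q x `` {w}, e)" "e \<in> arcs Q" "walk Q x (tail Q e) w"
    by (auto simp: arcs_universal_cover_iff)
  show "snd b \<in> arcs Q" using we by simp
  show "class_end Q x (tail (universal_cover Q x) b) = tail Q (snd b)"
    using assms by (auto simp: universal_cover_def)
  show "class_end Q x (head (universal_cover Q x) b) = head Q (snd b)"
    unfolding we(1) head_universal_cover[OF we(3,2)]
    using class_end_eq[OF walk.forward[OF we(3,2)]] by simp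
qed

lemma card_fibre_arcs_head:
  "finite {b \<in> arcs (universal_cover Q x). snd b = e \<and> head (universal_cover Q x) b = y} \<and>
   card {b \<in> arcs (universal_cover Q x). snd b = e \<and> head (universal_cover Q x) b = y} \<le> 1"
  (is "finite ?S \<and> _")
proof -
  have "b = b'" if "b \<in> ?S" "b' \<in> ?S" for b b'
  proof -
    from that obtain w where w: "b = (walk_equiv Q x `` {w}, e)" "e \<in> arcs Q" "walk Q x (tail Q e) w"
      by (auto simp: arcs_universal_cover_iff)
    from that obtain w' where w': "b' = (walk_equiv Q x `` {w'}, e)" "walk Q x (tail Q e) w'"
      by (auto simp: arcs_universal_cover_iff)
    have ew: "walk Q x (head Q e) (Fwd e # w)" "walk Q x (head Q e) (Fwd e # w')"
      using w w' by simp_all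
    have "walk_equiv Q x `` {Fwd e # w} = walk_equiv Q x `` {Fwd e # w'}"
      using that head_universal_cover[OF w(3,2)] head_universal_cover[OF w'(2) w(2)] w(1) w'(1)
      by simp
    then have "(Fwd e # w, Fwd e # w') \<in> walk_equiv Q x"
      by (rule eq_equiv_class[OF _ equiv_walk_equiv]) (use ew in \<open>auto simp: walks_from_def\<close>)
    moreover have "walk Q x (tail Q e) (Inv e # Fwd e # w)" "walk Q x (tail Q e) (Inv e # Fwd e # w')"
      using ew w(2) by simp_all
    ultimately have "(Inv e # Fwd e # w, Inv e # Fwd e # w') \<in> walk_equiv Q x"
      by (metis (mono_tags, lifting) walk_equiv_Cons walks_from_def mem_Collect_eq)
    moreover have "(Inv e # Fwd e # v, v) \<in> walk_equiv Q x" if "walk Q x (tail Q e) v" for v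
    proof -
      have "walk Q x (tail Q e) (Inv e # Fwd e # v)" using that w(2) by simp
      moreover have "cancel (Inv e # Fwd e # v) v" using cancel.intros(1)[of "[]"] by simp
      ultimately show ?thesis using that
        r_into_equivclp[of "\<lambda>v v'. v \<in> walks_from Q x \<and> v' \<in> walks_from Q x \<and> cancel v v'"]
        unfolding walk_equiv_def walks_from_def by blast
    qed
    ultimately have "(w, w') \<in> walk_equiv Q x"
      using w(3) w'(2) equiv_walk_equiv[of Q x] unfolding equiv_def by (meson symD transD)
    then show ?thesis using w(1) w'(1) equiv_class_eq[OF equiv_walk_equiv] by simp
  qed
  then obtain b where b: "?S \<subseteq> {b}" by blast
  show ?thesis
    using finite_subset[OF b] card_mono[OF _ b] by simp
qed

lemma vector_space_fun_scale:
  assumes "vector_space scale"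
  shows "vector_space (fun_scale scale)"
proof -
  interpret vector_space scale by fact
  show ?thesis
    by unfold_locales
      (simp_all add: fun_scale_def plus_fun_def scale_right_distrib scale_left_distrib)
qed

lemma is_rep_push_down:
  assumes "vector_space scale" and rep: "is_rep scale (universal_cover Q x) M"
  shows "is_rep (fun_scale scale) Q (push_down (universal_cover Q x) (class_end Q x) snd M)"
proof -
  interpret V: vector_space scale by fact
  interpret F: vector_space "fun_scale scale" using assms(1) by (rule vector_space_fun_scale)
  define C where "C = universal_cover Q x"
  define N where "N = push_down C (class_end Q x) snd M"
  interpret C: wf_digraph C unfolding C_def by (rule wf_universal_cover)
  have sub: "V.subspace (rep_space M y)" if "y \<in> verts C" for y
    using rep that by (simp add: is_rep_def C_def)
  have lin: "linear_between scale (rep_space M (tail C b)) (rep_space M (head C b)) (rep_map M b)"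
    if "b \<in> arcs C" for b
    using rep that by (simp add: is_rep_def C_def)
  have N_space: "f \<in> rep_space N i \<longleftrightarrow> finite {y. f y \<noteq> 0} \<and>
      (\<forall>y. y \<in> verts C \<and> class_end Q x y = i \<longrightarrow> f y \<in> rep_space M y) \<and>
      (\<forall>y. \<not> (y \<in> verts C \<and> class_end Q x y = i) \<longrightarrow> f y = 0)" for f i
    unfolding N_def push_down_def by (simp, metis)
  define B where "B e y = {b \<in> arcs C. snd b = e \<and> head C b = y}" for e y
  have N_map: "rep_map N e f y = (\<Sum>b\<in>B e y. rep_map M b (f (tail C b)))" for e f y
    by (simp add: N_def push_down_def B_def)
  have "F.subspace (rep_space N i)" for i
  proof (rule F.subspaceI)
    show "0 \<in> rep_space N i"
      unfolding N_space using sub V.subspace_0 by (simp add: zero_fun_def)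
  next
    fix f g assume f: "f \<in> rep_space N i" and g: "g \<in> rep_space N i"
    have "{y. (f + g) y \<noteq> 0} \<subseteq> {y. f y \<noteq> 0} \<union> {y. g y \<noteq> 0}" by auto
    then have "finite {y. (f + g) y \<noteq> 0}"
      using f g unfolding N_space by (meson finite_UnI finite_subset)
    then show "f + g \<in> rep_space N i"
      using f g sub V.subspace_add unfolding N_space by (simp add: plus_fun_def)
  next
    fix c f assume f: "f \<in> rep_space N i"
    have "{y. fun_scale scale c f y \<noteq> 0} \<subseteq> {y. f y \<noteq> 0}" by (auto simp: fun_scale_def)
    then have "finite {y. fun_scale scale c f y \<noteq> 0}"
      using f unfolding N_space by (meson finite_subset)
    then show "fun_scale scale c f \<in> rep_space N i"
      using f sub V.subspace_scale unfolding N_space by (simp add: fun_scale_def)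
  qed
  moreover have "linear_between (fun_scale scale) (rep_space N (tail Q e)) (rep_space N (head Q e))
      (rep_map N e)" if e: "e \<in> arcs Q" for e
  proof -
    have tail_mem: "f (tail C b) \<in> rep_space M (tail C b)"
      if "f \<in> rep_space N (tail Q e)" "b \<in> B e y" for f b y
    proof -
      have "class_end Q x (tail C b) = tail Q e" "tail C b \<in> verts C"
        using that(2) universal_cover_morphism(2)[of b Q x] by (auto simp: B_def C_def[symmetric])
      then show ?thesis using that(1) unfolding N_space by blast
    qed
    have "rep_map N e f \<in> rep_space N (head Q e)" if f: "f \<in> rep_space N (tail Q e)" for f
    proof -
      have zero: "rep_map M b 0 = 0" if "b \<in> arcs C" for b
      proof -
        have "0 \<in> rep_space M (tail C b)" using sub that V.subspace_0 by simp
        then have "rep_map M b (scale 0 0) = scale 0 (rep_map M b 0)"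
          using lin[OF that] unfolding linear_between_def by blast
        then show ?thesis by simp
      qed
      have "{y. rep_map N e f y \<noteq> 0} \<subseteq> (\<lambda>c. head C (c, e)) ` {y. f y \<noteq> 0}"
      proof
        fix y assume "y \<in> {y. rep_map N e f y \<noteq> 0}"
        then obtain b where b: "b \<in> B e y" "rep_map M b (f (tail C b)) \<noteq> 0"
          unfolding N_map by (metis (mono_tags, lifting) mem_Collect_eq sum.neutral)
        then have "f (tail C b) \<noteq> 0" using zero[of b] by (auto simp: B_def)
        moreover have "b = (tail C b, e)" "head C b = y"
          using b(1) by (auto simp: B_def C_def universal_cover_def)
        ultimately show "y \<in> (\<lambda>c. head C (c, e)) ` {y. f y \<noteq> 0}"
          by (metis (mono_tags, lifting) image_eqI mem_Collect_eq)
      qed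
      then have "finite {y. rep_map N e f y \<noteq> 0}"
        using f unfolding N_space by (meson finite_imageI finite_subset)
      moreover have "rep_map N e f y \<in> rep_space M y" if "y \<in> verts C" for y
        unfolding N_map
      proof (rule V.subspace_sum[OF sub[OF that]])
        fix b assume b: "b \<in> B e y"
        then have "b \<in> arcs C" "head C b = y" by (auto simp: B_def)
        then show "rep_map M b (f (tail C b)) \<in> rep_space M y"
          using lin[of b] tail_mem[OF f b] unfolding linear_between_def by blast
      qed
      moreover have "rep_map N e f y = 0" if "\<not> (y \<in> verts C \<and> class_end Q x y = head Q e)" for y
      proof -
        have "B e y = {}"
          using that universal_cover_morphism(3)[of _ Q x]
          by (auto simp: B_def C_def[symmetric])
        then show ?thesis by (simp add: N_map)
      qed
      ultimately show ?thesis unfolding N_space by blast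
    qed
    moreover have "rep_map N e (f + g) = rep_map N e f + rep_map N e g"
      if fg: "f \<in> rep_space N (tail Q e)" "g \<in> rep_space N (tail Q e)" for f g
    proof
      fix y
      have "rep_map M b ((f + g) (tail C b)) =
          rep_map M b (f (tail C b)) + rep_map M b (g (tail C b))" if "b \<in> B e y" for b
        using lin[of b] tail_mem[OF fg(1) that] tail_mem[OF fg(2) that] that
        unfolding linear_between_def B_def by simp
      then show "rep_map N e (f + g) y = (rep_map N e f + rep_map N e g) y"
        by (simp add: N_map sum.distrib)
    qed
    moreover have "rep_map N e (fun_scale scale c f) = fun_scale scale c (rep_map N e f)"
      if f: "f \<in> rep_space N (tail Q e)" for c f
    proof
      fix y
      have "rep_map M b (fun_scale scale c f (tail C b)) = scale c (rep_map M b (f (tail C b)))"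
        if "b \<in> B e y" for b
        using lin[of b] tail_mem[OF f that] that
        unfolding linear_between_def B_def fun_scale_def by simp
      then show "rep_map N e (fun_scale scale c f) y = fun_scale scale c (rep_map N e f) y"
        by (simp add: N_map fun_scale_def V.scale_sum_right)
    qed
    ultimately show ?thesis unfolding linear_between_def by blast
  qed
  ultimately show ?thesis unfolding is_rep_def N_def C_def by blast
qed

end

theory Submission
  imports Defs
begin

text \<open>
  Each vertex of the cover over the head of \<open>\<gamma>\<^sub>i\<close> is the end of exactly one arrow over \<open>\<gamma>\<^sub>i\<close>, and
  distinct arrows over \<open>\<gamma>\<^sub>i\<close> have distinct tails.  Hence \<open>N(\<gamma>\<^sub>i)\<close> is the direct sum of the maps
  \<open>M(\<delta>)\<close> over the arrows \<open>\<delta>\<close> above \<open>\<gamma>\<^sub>i\<close> and is surjective iff all of these are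
  (\<open>push_down_surj_iff\<close>).  This gives the equivalence of (b) and (c), and (a) implies (b) by
  taking unit vectors for \<open>\<alpha>\<close>.

  For (b) implies (a), fix \<open>i\<close> with \<open>\<alpha>\<^sub>i \<noteq> 0\<close>.  Assigning integers to the arrows of a quiver, and
  their negatives to the formal inverses, gives each walk a weight that is invariant under
  cancellation.  It therefore grades the vertices of the universal cover
  (\<open>class_weight_head\<close>).  With weight \<open>0\<close> for \<open>\<gamma>\<^sub>i\<close> and \<open>1\<close> for the other arrows, \<open>N\<close> becomes a
  graded vector space on which \<open>\<Sum>\<^sub>j \<alpha>\<^sub>jN(\<gamma>\<^sub>j)\<close> is the degree \<open>0\<close> surjection \<open>\<alpha>\<^sub>iN(\<gamma>\<^sub>i)\<close> plus a map
  of degree \<open>1\<close>.  Only finitely many degrees occur, because \<open>M\<close> has finite support, so the sum is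
  surjective like a block triangular matrix with surjective diagonal blocks
  (\<open>equal_images_of_surj_arrow\<close>).
\<close>

section \<open>Gradings of the universal cover\<close>

fun walk_weight :: "('e \<Rightarrow> int) \<Rightarrow> 'e letter list \<Rightarrow> int" where
  "walk_weight p [] = 0"
| "walk_weight p (Fwd e # w) = walk_weight p w + p e"
| "walk_weight p (Inv e # w) = walk_weight p w - p e"

definition class_weight :: "('e \<Rightarrow> int) \<Rightarrow> 'e letter list set \<Rightarrow> int" where
  "class_weight p c = walk_weight p (SOME w. w \<in> c)"

lemma walk_weight_append: "walk_weight p (u @ v) = walk_weight p u + walk_weight p v"
  by (induction p u rule: walk_weight.induct) simp_all

lemma walk_weight_cancel: "cancel v w \<Longrightarrow> walk_weight p v = walk_weight p w"
  by (induction rule: cancel.induct) (simp_all add: walk_weight_append)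

lemma walk_weight_equiv:
  assumes "(v, w) \<in> walk_equiv Q x"
  shows "walk_weight p v = walk_weight p w"
proof -
  from assms have "equivclp (\<lambda>v v'. v \<in> walks_from Q x \<and> v' \<in> walks_from Q x \<and> cancel v v') v w"
    by (simp add: walk_equiv_def)
  then show ?thesis
    by (induction rule: equivclp_induct) (auto dest: walk_weight_cancel[of _ _ p])
qed

lemma class_weight_eq:
  assumes "w \<in> walks_from Q x"
  shows "class_weight p (walk_equiv Q x `` {w}) = walk_weight p w"
proof -
  have "w \<in> walk_equiv Q x `` {w}"
    using assms by (simp add: walk_equiv_def)
  then have "(SOME v. v \<in> walk_equiv Q x `` {w}) \<in> walk_equiv Q x `` {w}"
    by (rule someI)
  then show ?thesis
    unfolding class_weight_def by (auto dest: walk_weight_equiv[of _ _ _ _ p])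
qed

lemma class_weight_head:
  assumes "b \<in> arcs (universal_cover Q x)"
  shows "class_weight p (head (universal_cover Q x) b) =
    class_weight p (tail (universal_cover Q x) b) + p (snd b)"
proof -
  obtain w e where b: "b = (walk_equiv Q x `` {w}, e)" and e: "e \<in> arcs Q"
    and w: "walk Q x (tail Q e) w"
    using assms by (auto simp: arcs_universal_cover_iff)
  have "w \<in> walks_from Q x" "Fwd e # w \<in> walks_from Q x"
    using w e by (auto simp: walks_from_def)
  moreover have "tail (universal_cover Q x) b = walk_equiv Q x `` {w}"
    by (simp add: b universal_cover_def)
  ultimately show ?thesis
    unfolding b head_universal_cover[OF w e] by (simp add: class_weight_eq b)
qed

section \<open>Unique lifting of arrows with prescribed head\<close>

text \<open>
  A walk \<open>w\<close> ending at the head of \<open>e\<close> is equivalent to \<open>e e\<^sup>-\<^sup>1 w\<close>, so the arrow over \<open>e\<close> that ends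
  in \<open>[w]\<close> starts in \<open>[e\<^sup>-\<^sup>1 w]\<close>.
\<close>

lemma arc_into_vertex:
  assumes "y \<in> verts (universal_cover Q x)" "e \<in> arcs Q" "class_end Q x y = head Q e"
  obtains b where "b \<in> arcs (universal_cover Q x)" "snd b = e" "head (universal_cover Q x) b = y"
proof -
  obtain w z where y: "y = walk_equiv Q x `` {w}" and "walk Q x z w"
    using assms(1) by (auto simp: universal_cover_def quotient_def walks_from_def)
  then have w: "walk Q x (head Q e) w"
    using class_end_eq[of Q x z w] assms(3) by simp
  then have w': "walk Q x (tail Q e) (Inv e # w)"
    using assms(2) by simp
  let ?R = "\<lambda>v v'. v \<in> walks_from Q x \<and> v' \<in> walks_from Q x \<and> cancel v v'"
  have "cancel (Fwd e # Inv e # w) w"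
    using cancel.intros(2)[of "[]" e w] by simp
  moreover have "Fwd e # Inv e # w \<in> walks_from Q x" "w \<in> walks_from Q x"
    using w w' assms(2) by (auto simp: walks_from_def)
  ultimately have "(Fwd e # Inv e # w, w) \<in> walk_equiv Q x"
    unfolding walk_equiv_def using r_into_equivclp[of ?R] by blast
  then have "walk_equiv Q x `` {Fwd e # Inv e # w} = y"
    unfolding y by (rule equiv_class_eq[OF equiv_walk_equiv])
  then have "head (universal_cover Q x) (walk_equiv Q x `` {Inv e # w}, e) = y"
    using head_universal_cover[OF w' assms(2)] by simp
  moreover have "(walk_equiv Q x `` {Inv e # w}, e) \<in> arcs (universal_cover Q x)"
    unfolding arcs_universal_cover_iff
    by (intro exI[of _ "Inv e # w"] exI[of _ e] conjI refl assms(2) w')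
  ultimately show thesis by (intro that) simp_all
qed

lemma arc_into_vertex_unique:
  assumes "b \<in> arcs (universal_cover Q x)" "b' \<in> arcs (universal_cover Q x)" "snd b = snd b'"
    "head (universal_cover Q x) b = head (universal_cover Q x) b'"
  shows "b = b'"
proof -
  have "b \<in> {b \<in> arcs (universal_cover Q x). snd b = snd b' \<and>
      head (universal_cover Q x) b = head (universal_cover Q x) b'}"
    "b' \<in> {b \<in> arcs (universal_cover Q x). snd b = snd b' \<and>
      head (universal_cover Q x) b = head (universal_cover Q x) b'}"
    using assms by simp_all
  then show ?thesis
    using card_fibre_arcs_head[of Q x "snd b'" "head (universal_cover Q x) b'"]
    by (metis (no_types, lifting) One_nat_def card_le_Suc0_iff_eq)
qed

section \<open>Push-downs of representations of the cover\<close>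

locale cover_rep = vector_space scale
  for scale :: "'k::field \<Rightarrow> 'v::ab_group_add \<Rightarrow> 'v" +
  fixes Q :: "('x, 'e) pre_digraph"
    and x :: 'x
    and M :: "('e letter list set, 'e letter list set \<times> 'e, 'v) quiver_rep"
  assumes rep: "is_rep scale (universal_cover Q x) M"
begin

abbreviation C where "C \<equiv> universal_cover Q x"
abbreviation N where "N \<equiv> push_down C (class_end Q x) snd M"

sublocale C: wf_digraph C
  by (rule wf_universal_cover)

sublocale F: vector_space "fun_scale scale"
  by (rule vector_space_fun_scale) (rule vector_space_axioms)

lemma rep_push_down: "is_rep (fun_scale scale) Q N"
  using vector_space_axioms rep by (rule is_rep_push_down)

lemma zero_in_rep_space: "y \<in> verts C \<Longrightarrow> 0 \<in> rep_space M y"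
  using rep by (simp add: is_rep_def subspace_0)

lemma rep_map_in: "b \<in> arcs C \<Longrightarrow> u \<in> rep_space M (tail C b) \<Longrightarrow> rep_map M b u \<in> rep_space M (head C b)"
  using rep by (simp add: is_rep_def linear_between_def)

lemma rep_map_zero:
  assumes "b \<in> arcs C"
  shows "rep_map M b 0 = 0"
proof -
  have "\<forall>u\<in>rep_space M (tail C b). rep_map M b (scale 0 u) = scale 0 (rep_map M b u)"
    using rep assms unfolding is_rep_def linear_between_def by blast
  from bspec[OF this zero_in_rep_space] assms show ?thesis by simp
qed

lemma push_down_space_iff:
  "f \<in> rep_space N i \<longleftrightarrow> finite {y. f y \<noteq> 0} \<and>
     (\<forall>y. f y \<noteq> 0 \<longrightarrow> y \<in> verts C \<and> class_end Q x y = i) \<and>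
     (\<forall>y\<in>verts C. f y \<in> rep_space M y)"
proof -
  have "f \<in> rep_space N i \<longleftrightarrow> finite {y. f y \<noteq> 0} \<and>
      (\<forall>y. if y \<in> verts C \<and> class_end Q x y = i then f y \<in> rep_space M y else f y = 0)"
    by (simp add: push_down_def)
  also have "(\<forall>y. if y \<in> verts C \<and> class_end Q x y = i then f y \<in> rep_space M y else f y = 0) \<longleftrightarrow>
      (\<forall>y. f y \<noteq> 0 \<longrightarrow> y \<in> verts C \<and> class_end Q x y = i) \<and> (\<forall>y\<in>verts C. f y \<in> rep_space M y)"
    using zero_in_rep_space by (metis (full_types))
  finally show ?thesis .
qed

text \<open>The sum that defines the push-down of a map has a single summand at each head.\<close>

lemma push_down_map_head:
  assumes "b \<in> arcs C"
  shows "rep_map N (snd b) f (head C b) = rep_map M b (f (tail C b))"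
proof -
  have "{b' \<in> arcs C. snd b' = snd b \<and> head C b' = head C b} = {b}"
    using assms arc_into_vertex_unique[of _ Q x b] by blast
  then show ?thesis by (simp add: push_down_def)
qed

lemma push_down_map_in:
  "e \<in> arcs Q \<Longrightarrow> f \<in> rep_space N (tail Q e) \<Longrightarrow> rep_map N e f \<in> rep_space N (head Q e)"
  using rep_push_down by (simp add: is_rep_def linear_between_def)

text \<open>
  One direction tests surjectivity on families concentrated at a single vertex.  In the other one,
  preimages are chosen separately along all arrows over \<open>e\<close>; as distinct arrows over \<open>e\<close> have
  distinct heads, the choices form a finitely supported family.
\<close>

lemma push_down_surj_iff:
  assumes e: "e \<in> arcs Q"
  shows "rep_map N e ` rep_space N (tail Q e) = rep_space N (head Q e) \<longleftrightarrow>
    (\<forall>b\<in>arcs C. snd b = e \<longrightarrow> rep_map M b ` rep_space M (tail C b) = rep_space M (head C b))"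
    (is "?L \<longleftrightarrow> ?R")
proof
  assume L: ?L
  show ?R
  proof (intro ballI impI equalityI subsetI)
    fix b v assume b: "b \<in> arcs C" "snd b = e"
    {
      assume "v \<in> rep_map M b ` rep_space M (tail C b)"
      then show "v \<in> rep_space M (head C b)" using rep_map_in b by blast
    }
    assume v: "v \<in> rep_space M (head C b)"
    define g where "g = (\<lambda>y. if y = head C b then v else 0)"
    have "finite {y. g y \<noteq> 0}"
      by (rule finite_subset[of _ "{head C b}"]) (auto simp: g_def)
    moreover have "head C b \<in> verts C" "class_end Q x (head C b) = head Q e"
      using b universal_cover_morphism(3)[OF b(1)] by auto
    ultimately have "g \<in> rep_space N (head Q e)"
      unfolding push_down_space_iff using v zero_in_rep_space by (auto simp: g_def)
    then have "g \<in> rep_map N e ` rep_space N (tail Q e)"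
      by (simp only: L)
    then obtain f where f: "f \<in> rep_space N (tail Q e)" "g = rep_map N e f"
      by (rule imageE)
    have "rep_map M b (f (tail C b)) = v"
      using push_down_map_head[OF b(1), of f] b(2) by (simp add: f(2)[symmetric]) (simp add: g_def)
    moreover have "f (tail C b) \<in> rep_space M (tail C b)"
      using f(1) b unfolding push_down_space_iff by simp
    ultimately show "v \<in> rep_map M b ` rep_space M (tail C b)" by blast
  qed
next
  assume R: ?R
  show ?L
  proof (intro equalityI subsetI)
    fix g assume "g \<in> rep_map N e ` rep_space N (tail Q e)"
    then show "g \<in> rep_space N (head Q e)" using push_down_map_in[OF e] by blast
  next
    fix g assume g: "g \<in> rep_space N (head Q e)"
    (* Choosing 0 over 0 is what keeps the family of preimages finitely supported. *)
    have "\<exists>u. u \<in> rep_space M c \<and> rep_map M (c, e) u = g (head C (c, e)) \<and>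
        (g (head C (c, e)) = 0 \<longrightarrow> u = 0)" if c: "(c, e) \<in> arcs C" for c
    proof (cases "g (head C (c, e)) = 0")
      case True
      have "tail C (c, e) = c" by (simp add: universal_cover_def)
      with True c show ?thesis
        using rep_map_zero zero_in_rep_space C.tail_in_verts[OF c] by (intro exI[of _ 0]) auto
    next
      case False
      have "g (head C (c, e)) \<in> rep_space M (head C (c, e))"
        using g c unfolding push_down_space_iff by simp
      then have "g (head C (c, e)) \<in> rep_map M (c, e) ` rep_space M (tail C (c, e))"
        using R c by simp
      moreover have "tail C (c, e) = c" by (simp add: universal_cover_def)
      ultimately show ?thesis using False by auto
    qed
    then obtain s where s: "\<And>c. (c, e) \<in> arcs C \<Longrightarrow> s c \<in> rep_space M c \<and>
        rep_map M (c, e) (s c) = g (head C (c, e)) \<and> (g (head C (c, e)) = 0 \<longrightarrow> s c = 0)"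
      by metis
    define f where "f c = (if (c, e) \<in> arcs C then s c else 0)" for c
    have tail: "tail C (c, e) = c" for c
      by (simp add: universal_cover_def)
    have "inj_on (\<lambda>c. head C (c, e)) {c. (c, e) \<in> arcs C}"
      by (auto intro!: inj_onI dest: arc_into_vertex_unique)
    moreover have "finite {y. g y \<noteq> 0}" using g unfolding push_down_space_iff by blast
    ultimately have "finite ((\<lambda>c. head C (c, e)) -` {y. g y \<noteq> 0} \<inter> {c. (c, e) \<in> arcs C})"
      by (rule finite_vimage_IntI[rotated])
    then have "finite {c. f c \<noteq> 0}"
      by (rule rev_finite_subset) (use s in \<open>auto simp: f_def split: if_splits\<close>)
    moreover have "c \<in> verts C \<and> class_end Q x c = tail Q e" if "f c \<noteq> 0" for c
    proof -
      have "(c, e) \<in> arcs C" using that by (auto simp: f_def split: if_splits)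
      then show ?thesis
        using C.tail_in_verts universal_cover_morphism(2) tail by (metis snd_conv)
    qed
    ultimately have f: "f \<in> rep_space N (tail Q e)"
      unfolding push_down_space_iff using s zero_in_rep_space by (auto simp: f_def)
    have "rep_map N e f y = g y" for y
    proof (cases "y \<in> verts C \<and> class_end Q x y = head Q e")
      case True
      then obtain b where b: "b \<in> arcs C" "snd b = e" "head C b = y"
        using arc_into_vertex e by metis
      then have "b = (tail C b, e)" by (auto simp: universal_cover_def)
      then show ?thesis
        using push_down_map_head[OF b(1), of f] b s[of "tail C b"] by (auto simp: f_def)
    next
      case False
      then show ?thesis
        using g push_down_map_in[OF e f] unfolding push_down_space_iff by metis
    qed
    then have "rep_map N e f = g" by blast
    then show "g \<in> rep_map N e ` rep_space N (tail Q e)" using f by blast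
  qed
qed

lemma push_down_map_truncate:
  fixes \<phi> :: "'e letter list set \<Rightarrow> bool"
  assumes "b \<in> arcs C"
  shows "rep_map N (snd b) (\<lambda>c. if \<phi> c then f c else 0) (head C b) =
    (if \<phi> (tail C b) then rep_map N (snd b) f (head C b) else 0)"
  using assms by (simp add: push_down_map_head rep_map_zero)

end

section \<open>Combinations of the arrow maps of a Kronecker quiver\<close>

locale kronecker_cover_rep = cover_rep scale "kronecker r" x M
  for scale :: "'k::field \<Rightarrow> 'v::ab_group_add \<Rightarrow> 'v"
    and r x :: nat
    and M :: "(cover_vertex, cover_arrow, 'v) quiver_rep"
begin

text \<open>
  This is the step from one surjective arrow to the linear combinations.  Give \<open>\<gamma>\<^sub>i\<close> weight \<open>0\<close> and
  every other arrow weight \<open>1\<close>, and filter the push-down by the weight of the supporting vertices.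
  A preimage under \<open>\<alpha>\<^sub>iN(\<gamma>\<^sub>i)\<close> of an element of some filtration step may be taken in the same
  step, as \<open>N(\<gamma>\<^sub>i)\<close> commutes with truncation; the remaining summands only produce an error in the
  next step.  Finite support of \<open>M\<close> bounds the filtration, so finitely many corrections remove
  the error.
\<close>

lemma equal_images_of_surj_arrow:
  assumes finite: "finite {y \<in> verts C. rep_space M y \<noteq> {0}}"
    and i: "i \<in> {1..r}" "\<alpha> i \<noteq> 0"
    and surj: "rep_map N i ` rep_space N 1 = rep_space N 2"
  shows "(\<lambda>f. \<Sum>j=1..r. fun_scale scale (\<alpha> j) (rep_map N j f)) ` rep_space N 1 = rep_space N 2"
proof -
  define A where "A f = (\<Sum>j=1..r. fun_scale scale (\<alpha> j) (rep_map N j f))" for f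
  define wt where "wt = class_weight (\<lambda>j. if j = i then 0 else 1)"
  have sub: "F.subspace (rep_space N 1)" "F.subspace (rep_space N 2)"
    and lin: "linear_between (fun_scale scale) (rep_space N 1) (rep_space N 2) (rep_map N j)"
    if "j \<in> {1..r}" for j
    using rep_push_down that by (simp_all add: is_rep_def kronecker_def)
  note sub = sub[OF i(1)]
  have A_in: "A f \<in> rep_space N 2" if "f \<in> rep_space N 1" for f
    unfolding A_def using lin that
    by (intro F.subspace_sum F.subspace_scale sub) (auto simp: linear_between_def)
  have A_add: "A (f + g) = A f + A g" if "f \<in> rep_space N 1" "g \<in> rep_space N 1" for f g
  proof -
    have "fun_scale scale (\<alpha> j) (rep_map N j (f + g)) =
        fun_scale scale (\<alpha> j) (rep_map N j f) + fun_scale scale (\<alpha> j) (rep_map N j g)"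
      if "j \<in> {1..r}" for j
      using lin[OF that] \<open>f \<in> _\<close> \<open>g \<in> _\<close> by (simp add: linear_between_def F.scale_right_distrib)
    then show ?thesis unfolding A_def by (simp add: sum.distrib)
  qed
  have A_apply: "A f y = (\<Sum>j=1..r. scale (\<alpha> j) (rep_map N j f y))" for f y
  proof -
    have "(\<Sum>j\<in>S. h j) y = (\<Sum>j\<in>S. h j y)" for h :: "nat \<Rightarrow> cover_vertex \<Rightarrow> 'v" and S
      by (induction S rule: infinite_finite_induct) simp_all
    then show ?thesis by (simp add: A_def fun_scale_def)
  qed
  (* In weights \<ge> T the push-down vanishes, so the induction may start there and go downwards. *)
  obtain T where T: "\<And>y. y \<in> verts C \<Longrightarrow> rep_space M y \<noteq> {0} \<Longrightarrow> wt y < T"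
  proof
    fix y assume "y \<in> verts C" "rep_space M y \<noteq> {0}"
    then have "wt y \<le> Max (wt ` {y \<in> verts C. rep_space M y \<noteq> {0}})"
      using finite by (intro Max_ge) auto
    then show "wt y < Max (wt ` {y \<in> verts C. rep_space M y \<noteq> {0}}) + 1" by simp
  qed
  have "\<exists>f\<in>rep_space N 1. A f = g"
    if "g \<in> rep_space N 2" "\<And>y. g y \<noteq> 0 \<Longrightarrow> T - int n \<le> wt y" for n g
    using that
  proof (induction n arbitrary: g)
    case 0
    have "g y = 0" for y
    proof (rule ccontr)
      assume "g y \<noteq> 0"
      then have "y \<in> verts C" "g y \<in> rep_space M y" "T \<le> wt y"
        using 0 unfolding push_down_space_iff by auto
      with T[of y] \<open>g y \<noteq> 0\<close> show False by auto
    qed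
    then have "g = 0" by (simp add: fun_eq_iff)
    moreover have "A 0 = 0"
      using A_add[of 0 0] F.subspace_0[OF sub(1)] by simp
    ultimately show ?case using F.subspace_0[OF sub(1)] by blast
  next
    case (Suc n)
    have "fun_scale scale (inverse (\<alpha> i)) g \<in> rep_map N i ` rep_space N 1"
      unfolding surj by (rule F.subspace_scale[OF sub(2) Suc.prems(1)])
    then obtain f0 where f0: "f0 \<in> rep_space N 1" "fun_scale scale (inverse (\<alpha> i)) g = rep_map N i f0"
      by (rule imageE)
    (* Dropping the low weights of f0 keeps the arrows of weight 1 from disturbing weights
       below the next filtration step. *)
    define f where "f = (\<lambda>c. if T - int (Suc n) \<le> wt c then f0 c else 0)"
    have "finite {c. f c \<noteq> 0}"
      by (rule finite_subset[of _ "{c. f0 c \<noteq> 0}"])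
        (use f0(1) in \<open>auto simp: f_def push_down_space_iff\<close>)
    then have f: "f \<in> rep_space N 1"
      using f0(1) zero_in_rep_space unfolding push_down_space_iff by (auto simp: f_def)
    have diff: "g - A f \<in> rep_space N 2"
      using Suc.prems(1) A_in[OF f] by (rule F.subspace_diff[OF sub(2)])
    have "T - int n \<le> wt y" if y: "(g - A f) y \<noteq> 0" for y
    proof (rule ccontr)
      assume low: "\<not> T - int n \<le> wt y"
      have "y \<in> verts C \<and> class_end (kronecker r) x y = 2"
        using diff y unfolding push_down_space_iff by blast
      then have y2: "y \<in> verts C" "class_end (kronecker r) x y = 2" by simp_all
      have "rep_map N j f y = (if j = i then fun_scale scale (inverse (\<alpha> i)) g y else 0)"
        if j: "j \<in> {1..r}" for j
      proof -
        obtain b where b: "b \<in> arcs C" "snd b = j" "head C b = y"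
          using arc_into_vertex[OF y2(1), of j] y2(2) j by (auto simp: kronecker_def)
        have wt: "wt y = wt (tail C b) + (if j = i then 0 else 1)"
          using class_weight_head[OF b(1)] b unfolding wt_def by simp
        have *: "rep_map N j f y = (if T - int (Suc n) \<le> wt (tail C b) then rep_map N j f0 y else 0)"
          using push_down_map_truncate[OF b(1), of "\<lambda>c. T - int (Suc n) \<le> wt c" f0] b
          unfolding f_def by simp
        show ?thesis
        proof (cases "j = i \<and> T - int (Suc n) \<le> wt y")
          case True
          with wt have "rep_map N j f y = rep_map N j f0 y" using * by simp
          with True show ?thesis by (simp add: f0(2))
        next
          case False
          then have "rep_map N j f y = 0" using * wt low by (auto split: if_splits)
          moreover have "g y = 0" if "j = i" using False that Suc.prems(2) by blast
          ultimately show ?thesis by (simp add: fun_scale_def)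
        qed
      qed
      then have "A f y = (\<Sum>j=1..r. if j = i then g y else 0)"
        unfolding A_apply using i(2) by (intro sum.cong) (auto simp: fun_scale_def)
      then have "A f y = g y" using i(1) by simp
      with y show False by simp
    qed
    from Suc.IH[OF diff this] obtain f' where "f' \<in> rep_space N 1" "A f' = g - A f" by blast
    then have "A (f + f') = g" "f + f' \<in> rep_space N 1"
      using A_add f F.subspace_add[OF sub(1)] by simp_all
    then show ?case by blast
  qed
  note filtered = this
  have "\<exists>f\<in>rep_space N 1. A f = g" if g: "g \<in> rep_space N 2" for g
  proof -
    have fin: "finite {y. g y \<noteq> 0}" using g unfolding push_down_space_iff by blast
    define n where "n = nat (Max (insert 0 ((\<lambda>y. T - wt y) ` {y. g y \<noteq> 0})))"
    have "T - int n \<le> wt y" if "g y \<noteq> 0" for y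
    proof -
      have "T - wt y \<le> Max (insert 0 ((\<lambda>y. T - wt y) ` {y. g y \<noteq> 0}))"
        using fin that by (intro Max_ge) auto
      then show ?thesis unfolding n_def by linarith
    qed
    then show ?thesis using filtered[OF g] by blast
  qed
  then show ?thesis using A_in unfolding A_def by blast
qed

end

section \<open>Equal images and surjectivity on the cover\<close>

theorem corollary3p2:
  fixes scale :: "'k::alg_closed_field \<Rightarrow> 'v::ab_group_add \<Rightarrow> 'v"
    and r :: nat
    and M :: "(cover_vertex, cover_arrow, 'v) quiver_rep"
    and N :: "(nat, nat, cover_vertex \<Rightarrow> 'v) quiver_rep"
  assumes "vector_space scale"
    and "r \<ge> 3"
    and "fin_dim_rep scale (kronecker_cover r) M"
    and "indecomposable_rep scale (kronecker_cover r) M"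
    and "N = kronecker_push_down r M"
  shows "(equal_images_property (fun_scale scale) r N \<longleftrightarrow>
            (\<forall>i\<in>{1..r}. rep_map N i ` rep_space N 1 = rep_space N 2)) \<and>
         ((\<forall>i\<in>{1..r}. rep_map N i ` rep_space N 1 = rep_space N 2) \<longleftrightarrow>
            surj_rep (kronecker_cover r) M)"
proof -
  interpret vector_space scale by fact
  interpret P: kronecker_cover_rep scale r 1 M
    using assms(3) by unfold_locales (simp add: fin_dim_rep_def kronecker_cover_def)
  have N: "N = P.N"
    by (simp add: assms(5) kronecker_push_down_def kronecker_cover_def)
  have finite: "finite {y \<in> verts P.C. rep_space M y \<noteq> {0}}"
    using assms(3) by (simp add: fin_dim_rep_def kronecker_cover_def)
  have ab: "rep_map N i ` rep_space N 1 = rep_space N 2"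
    if eip: "equal_images_property (fun_scale scale) r N" and i: "i \<in> {1..r}" for i
  proof -
    define \<alpha> :: "nat \<Rightarrow> 'k" where "\<alpha> j = (if j = i then 1 else 0)" for j
    have "fun_scale scale (\<alpha> j) v = (if j = i then v else 0)"
    for j and v :: "cover_vertex \<Rightarrow> 'v"
      by (simp add: \<alpha>_def fun_scale_def fun_eq_iff)
    then have "(\<Sum>j=1..r. fun_scale scale (\<alpha> j) (rep_map N j v)) = rep_map N i v" for v
      using i by simp
    moreover have "\<exists>j\<in>{1..r}. \<alpha> j \<noteq> 0" using i by (auto simp: \<alpha>_def)
    ultimately show ?thesis
      using eip unfolding equal_images_property_def by (metis (no_types, lifting) image_cong)
  qed
  have ba: "equal_images_property (fun_scale scale) r N"
    if "\<forall>i\<in>{1..r}. rep_map N i ` rep_space N 1 = rep_space N 2"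
    unfolding equal_images_property_def
  proof (intro allI impI, elim bexE)
    fix \<alpha> :: "nat \<Rightarrow> 'k" and i
    assume i: "i \<in> {1..r}" and \<alpha>: "\<alpha> i \<noteq> 0"
    show "(\<lambda>v. \<Sum>j=1..r. fun_scale scale (\<alpha> j) (rep_map N j v)) ` rep_space N 1 = rep_space N 2"
      unfolding N
      by (rule P.equal_images_of_surj_arrow[of i \<alpha>, OF finite i \<alpha> bspec[OF that i, unfolded N]])
  qed
  have bc: "(\<forall>i\<in>{1..r}. rep_map N i ` rep_space N 1 = rep_space N 2) \<longleftrightarrow>
      surj_rep (kronecker_cover r) M"
  proof -
    have surj_iff: "rep_map N i ` rep_space N 1 = rep_space N 2 \<longleftrightarrow> (\<forall>b\<in>arcs P.C. snd b = i \<longrightarrow>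
        rep_map M b ` rep_space M (tail P.C b) = rep_space M (head P.C b))" if "i \<in> {1..r}" for i
      using P.push_down_surj_iff[of i] that by (simp add: N kronecker_def)
    have "snd b \<in> {1..r}" if "b \<in> arcs P.C" for b
      using universal_cover_morphism(1)[OF that] by (simp add: kronecker_def)
    then have arcs_over: "(\<forall>i\<in>{1..r}. \<forall>b\<in>arcs P.C. snd b = i \<longrightarrow> S b) \<longleftrightarrow> (\<forall>b\<in>arcs P.C. S b)" for S
      by blast
    have "(\<forall>i\<in>{1..r}. rep_map N i ` rep_space N 1 = rep_space N 2) \<longleftrightarrow>
        (\<forall>i\<in>{1..r}. \<forall>b\<in>arcs P.C. snd b = i \<longrightarrow>
          rep_map M b ` rep_space M (tail P.C b) = rep_space M (head P.C b))"
      by (intro ball_cong refl surj_iff)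
    also have "\<dots> \<longleftrightarrow> surj_rep (kronecker_cover r) M"
      unfolding surj_rep_def kronecker_cover_def by (rule arcs_over)
    finally show ?thesis .
  qed
  show ?thesis
    by (intro conjI iffI ballI bc) (use ab ba in simp_all)
qed

end
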